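(* Consider the $JT_\mu$ flow of the BMS free fermion with seed Lagrangian $\mathcal L^{(0)}=\psi_1\partial_x\psi_1-\frac12\psi_2\partial_y\psi_1-\frac12\psi_1\partial_y\psi_2$: let the coefficients $\mathcal L_{\mu_1\cdots\mu_n}$ ($\mu_i\in\{x,y\}$, with $\mathcal L_{\mu_1\cdots\mu_n}|_{n=0}=\mathcal L^{(0)}$) be determined by the recursion, for $n\ge0$, $$\mathcal L_{\mu_1\cdots\mu_n\mu_{n+1}}=\sum_{i=0}^n\binom ni\left[(J^y)_{\mu_{i+1}\cdots\mu_n}(T^x_{\ \mu_{n+1}})_{\mu_1\cdots\mu_i}-(J^x)_{\mu_{i+1}\cdots\mu_n}(T^y_{\ \mu_{n+1}})_{\mu_1\cdots\mu_i}\right],$$ where, at every order (including order zero, without imposing the equations of motion), $$(T^\alpha_{\ \mu})_{\mu_1\cdots\mu_n}=\frac{\partial\mathcal L_{\mu_1\cdots\mu_n}}{\partial(\partial_\alpha\psi_a)}\partial_\mu\psi_a-\delta^\alpha_{\ \mu}\mathcal L_{\mu_1\cdots\mu_n},$$ $$(J^\beta)_{\mu_1\cdots\mu_n}=\frac12\frac{\partial\mathcal L_{\mu_1\cdots\mu_n}}{\partial(\partial_\beta\psi_2)}\psi_2-\frac12\frac{\partial\mathcal L_{\mu_1\cdots\mu_n}}{\partial(\partial_\beta\psi_1)}\psi_1 .$$ Then $\mathcal L_{\mu_1\cdots\mu_n}=0$ for all $n\ge1$ and all indices; consequently the deformed Lagrangian $\mathcal L^{[\lambda]}=\sum_{n\ge0}\frac1{n!}\lambda^{\mu_1}\cdots\lambda^{\mu_n}\mathcal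 L_{\mu_1\cdots\mu_n}$ equals $\mathcal L^{(0)}$.
   Context: $\psi_1,\psi_2$ are anticommuting (Grassmann) fields; $\psi_a$ and their derivatives $\partial_x\psi_a,\partial_y\psi_a$ ($a=1,2$) are odd generators of a Grassmann algebra, so each squares to zero and they anticommute pairwise. Repeated indices are summed ($a\in\{1,2\}$, spacetime indices in $\{x,y\}$). Derivatives $\partial/\partial(\partial_\mu\psi_a)$ are right derivatives (the differentiated factor is moved to the right and removed). With these conventions the seed current is $J^y_{(0)}=-\frac12\psi_1\psi_2$, $J^x_{(0)}=0$. The recursion is the Taylor expansion of the flow $\partial\mathcal L^{[\lambda]}/\partial\lambda^\mu=J^y_{[\lambda]}T^{x[\lambda]}_{\ \mu}-J^x_{[\lambda]}T^{y[\lambda]}_{\ \mu}$. *)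

theory Defs
  imports "HOL-Analysis.Analysis"
begin

section \<open>Finitely generated Grassmann algebras\<close>

text \<open>
  An element of the Grassmann algebra over the coefficient ring \<open>'k\<close> with odd generators \<open>'g\<close>
  is given by its coefficients with respect to the monomial basis: the coefficient at a set \<open>S\<close>
  belongs to the product of the generators in \<open>S\<close>, taken in increasing order. The linear order on
  \<open>'g\<close> only selects this basis.
\<close>

typedef ('g, 'k) grassmann = "UNIV :: ('g set \<Rightarrow> 'k) set"
  morphisms coeff Grassmann
  by simp

setup_lifting type_definition_grassmann

lemma grassmann_eqI: "(\<And>S. coeff f S = coeff g S) \<Longrightarrow> f = g"
  by transfer auto

definition inversions :: "'g::linorder set \<Rightarrow> 'g set \<Rightarrow> nat" where
  "inversions A B = card {(a, b). a \<in> A \<and> b \<in> B \<and> b < a}"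

text \<open>The sign of the shuffle that sorts a product of two increasing monomials.\<close>

definition shuffle_sign :: "'g::linorder set \<Rightarrow> 'g set \<Rightarrow> 'k::comm_ring_1" where
  "shuffle_sign A B = (-1) ^ inversions A B"

instantiation grassmann :: (type, comm_ring_1) ab_group_add
begin

lift_definition zero_grassmann :: "('a, 'b) grassmann" is "\<lambda>S. 0" .

lift_definition plus_grassmann :: "('a, 'b) grassmann \<Rightarrow> ('a, 'b) grassmann \<Rightarrow> ('a, 'b) grassmann"
  is "\<lambda>f g S. f S + g S" .

lift_definition uminus_grassmann :: "('a, 'b) grassmann \<Rightarrow> ('a, 'b) grassmann"
  is "\<lambda>f S. - f S" .

lift_definition minus_grassmann :: "('a, 'b) grassmann \<Rightarrow> ('a, 'b) grassmann \<Rightarrow> ('a, 'b) grassmann"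
  is "\<lambda>f g S. f S - g S" .

instance
  by standard (transfer; auto)+

end

lemma inversions_Un_left:
  fixes A B C :: "'g::{finite,linorder} set"
  assumes "A \<inter> B = {}"
  shows "inversions (A \<union> B) C = inversions A C + inversions B C"
proof -
  have "{(a, b). a \<in> A \<union> B \<and> b \<in> C \<and> b < a} =
      {(a, b). a \<in> A \<and> b \<in> C \<and> b < a} \<union> {(a, b). a \<in> B \<and> b \<in> C \<and> b < a}"
    by auto
  then show ?thesis
    unfolding inversions_def using assms by (simp add: card_Un_disjoint disjoint_iff)
qed

lemma inversions_Un_right:
  fixes A B C :: "'g::{finite,linorder} set"
  assumes "B \<inter> C = {}"
  shows "inversions A (B \<union> C) = inversions A B + inversions A C"
proof -
  have "{(a, b). a \<in> A \<and> b \<in> B \<union> C \<and> b < a} =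
      {(a, b). a \<in> A \<and> b \<in> B \<and> b < a} \<union> {(a, b). a \<in> A \<and> b \<in> C \<and> b < a}"
    by auto
  then show ?thesis
    unfolding inversions_def using assms by (simp add: card_Un_disjoint disjoint_iff)
qed

lemma shuffle_sign_empty [simp]: "shuffle_sign {} B = 1" "shuffle_sign A {} = 1"
  by (simp_all add: shuffle_sign_def inversions_def)

lemma shuffle_sign_square [simp]: "shuffle_sign A B * shuffle_sign A B = 1"
  by (simp add: shuffle_sign_def flip: power_mult_distrib)

lemma shuffle_sign_square_left [simp]: "shuffle_sign A B * (shuffle_sign A B * c) = c"
  by (simp flip: mult.assoc)

lemma shuffle_sign_Un_left:
  fixes A B C :: "'g::{finite,linorder} set"
  shows "A \<inter> B = {} \<Longrightarrow> shuffle_sign (A \<union> B) C = shuffle_sign A C * shuffle_sign B C"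
  by (simp add: shuffle_sign_def inversions_Un_left power_add)

lemma shuffle_sign_Un_right:
  fixes A B C :: "'g::{finite,linorder} set"
  shows "B \<inter> C = {} \<Longrightarrow> shuffle_sign A (B \<union> C) = shuffle_sign A B * shuffle_sign A C"
  by (simp add: shuffle_sign_def inversions_Un_right power_add)

lemma shuffle_sign_singletons:
  "shuffle_sign {a} {b} = (if b < a then -1 else 1)"
proof -
  have "{(x, y). x \<in> {a} \<and> y \<in> {b} \<and> y < x} = (if b < a then {(a, b)} else {})"
    by auto
  then show ?thesis
    by (simp add: shuffle_sign_def inversions_def)
qed

instantiation grassmann :: ("{finite, linorder}", comm_ring_1) ring_1
begin

lift_definition one_grassmann :: "('a, 'b) grassmann" is "\<lambda>S. if S = {} then 1 else 0" .

lift_definition times_grassmann :: "('a, 'b) grassmann \<Rightarrow> ('a, 'b) grassmann \<Rightarrow> ('a, 'b) grassmann"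
  is "\<lambda>f g S. \<Sum>A \<in> Pow S. shuffle_sign A (S - A) * f A * g (S - A)" .

instance
proof
  fix f g h :: "('a, 'b) grassmann"
  show "f * g * h = f * (g * h)"
  proof (rule grassmann_eqI)
    fix S :: "'a set"
    let ?F = "coeff f" and ?G = "coeff g" and ?H = "coeff h"
    have "coeff (f * g * h) S =
        (\<Sum>U \<in> Pow S. \<Sum>A \<in> Pow U. shuffle_sign U (S - U) *
          (shuffle_sign A (U - A) * ?F A * ?G (U - A)) * ?H (S - U))"
      by (simp add: times_grassmann.rep_eq sum_distrib_left sum_distrib_right)
    also have "\<dots> = (\<Sum>(U, A) \<in> Sigma (Pow S) Pow. shuffle_sign U (S - U) *
          (shuffle_sign A (U - A) * ?F A * ?G (U - A)) * ?H (S - U))"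
      by (rule sum.Sigma) auto
    also have "\<dots> = (\<Sum>(A, B) \<in> (SIGMA A:Pow S. Pow (S - A)). shuffle_sign A (S - A) * ?F A *
          (shuffle_sign B (S - A - B) * ?G B * ?H (S - A - B)))"
    proof (rule sum.reindex_bij_witness
        [where i = "\<lambda>(A, B). (A \<union> B, A)" and j = "\<lambda>(U, A). (A, U - A)"], goal_cases)
      case (5 p)
      then obtain U A where p: "p = (U, A)" and AU: "A \<subseteq> U" and US: "U \<subseteq> S"
        by auto
      have U: "U = A \<union> (U - A)" and SA: "S - A = (U - A) \<union> (S - U)"
        and SAU: "S - A - (U - A) = S - U"
        using AU US by auto
      have 1: "(shuffle_sign U (S - U) :: 'b) =
          shuffle_sign A (S - U) * shuffle_sign (U - A) (S - U)"
        by (subst U, rule shuffle_sign_Un_left) auto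
      have 2: "(shuffle_sign A (S - A) :: 'b) =
          shuffle_sign A (U - A) * shuffle_sign A (S - U)"
        by (subst SA, rule shuffle_sign_Un_right) auto
      show ?case
        unfolding p prod.case SAU 1 2 by (simp add: ac_simps)
    qed auto
    also have "\<dots> = (\<Sum>A \<in> Pow S. \<Sum>B \<in> Pow (S - A). shuffle_sign A (S - A) * ?F A *
          (shuffle_sign B (S - A - B) * ?G B * ?H (S - A - B)))"
      by (rule sum.Sigma [symmetric]) auto
    also have "\<dots> = coeff (f * (g * h)) S"
      by (simp add: times_grassmann.rep_eq sum_distrib_left)
    finally show "coeff (f * g * h) S = coeff (f * (g * h)) S" .
  qed
  show "(f + g) * h = f * h + g * h"
    by (rule grassmann_eqI)
      (simp add: times_grassmann.rep_eq plus_grassmann.rep_eq algebra_simps sum.distrib)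
  show "f * (g + h) = f * g + f * h"
    by (rule grassmann_eqI)
      (simp add: times_grassmann.rep_eq plus_grassmann.rep_eq algebra_simps sum.distrib)
  show "1 * f = f"
  proof (rule grassmann_eqI)
    fix S
    have "coeff (1 * f) S = (\<Sum>A \<in> Pow S. if A = {} then coeff f S else 0)"
      unfolding times_grassmann.rep_eq one_grassmann.rep_eq by (rule sum.cong) auto
    then show "coeff (1 * f) S = coeff f S"
      by simp
  qed
  show "f * 1 = f"
  proof (rule grassmann_eqI)
    fix S
    have "coeff (f * 1) S = (\<Sum>A \<in> Pow S. if A = S then coeff f S else 0)"
      unfolding times_grassmann.rep_eq one_grassmann.rep_eq by (rule sum.cong) auto
    then show "coeff (f * 1) S = coeff f S"
      by simp
  qed
  show "(0::('a, 'b) grassmann) \<noteq> 1"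
  proof
    assume "(0::('a, 'b) grassmann) = 1"
    then have "coeff (0::('a, 'b) grassmann) {} = coeff 1 {}"
      by simp
    then show False
      by (simp add: zero_grassmann.rep_eq one_grassmann.rep_eq)
  qed
qed

end

lift_definition gscale :: "'k::comm_ring_1 \<Rightarrow> ('g, 'k) grassmann \<Rightarrow> ('g, 'k) grassmann"
    (infixr "*\<^sub>G" 75)
  is "\<lambda>c f S. c * f S" .

lift_definition gen :: "'g \<Rightarrow> ('g, 'k::comm_ring_1) grassmann"
  is "\<lambda>g S. if S = {g} then 1 else 0" .

text \<open>
  Right derivative with respect to a generator: for \<open>g \<notin> S\<close>, the sorted monomial of \<open>S \<union> {g}\<close> is
  \<open>shuffle_sign S {g}\<close> times the monomial of \<open>S\<close> followed by \<open>g\<close>, and this last factor is removed.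
  The lemma \<open>rderiv_mult_gen\<close> below is the resulting product rule.
\<close>

lift_definition rderiv ::
    "'g::{finite,linorder} \<Rightarrow> ('g, 'k::comm_ring_1) grassmann \<Rightarrow> ('g, 'k) grassmann"
  is "\<lambda>g f S. if g \<in> S then 0 else shuffle_sign S {g} * f (insert g S)" .

lemma coeff_mult_gen:
  fixes f :: "('g::{finite,linorder}, 'k::comm_ring_1) grassmann"
  shows "coeff (f * gen h) S =
    (if h \<in> S then shuffle_sign (S - {h}) {h} * coeff f (S - {h}) else 0)"
proof -
  let ?c = "shuffle_sign (S - {h}) {h} * coeff f (S - {h})"
  have "coeff (f * gen h) S = (\<Sum>A \<in> Pow S. if A = S - {h} then if h \<in> S then ?c else 0 else 0)"
    unfolding times_grassmann.rep_eq gen.rep_eq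
  proof (rule sum.cong)
    fix A assume "A \<in> Pow S"
    then have *: "S - A = {h} \<longleftrightarrow> A = S - {h} \<and> h \<in> S"
      by blast
    show "shuffle_sign A (S - A) * coeff f A * (if S - A = {h} then 1 else 0) =
        (if A = S - {h} then if h \<in> S then ?c else 0 else 0)"
    proof (cases "A = S - {h} \<and> h \<in> S")
      case True
      then have 1: "S - A = {h}" and 2: "A = S - {h}" "h \<in> S"
        using * by blast+
      show ?thesis
        unfolding 1 using 2 by simp
    next
      case False
      then have "S - A \<noteq> {h}"
        using * by blast
      then show ?thesis
        using False by (simp only: if_False mult_zero_right) (metis (full_types))
    qed
  qed (rule refl)
  also have "\<dots> = (if h \<in> S then ?c else 0)"
    by (subst sum.delta) auto
  finally show ?thesis .
qed

lemma coeff_gen_mult_gen: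
  fixes g h :: "'g::{finite,linorder}"
  shows "coeff (gen g * gen h :: ('g, 'k::comm_ring_1) grassmann) S =
    (if g \<noteq> h \<and> S = {g, h} then shuffle_sign {g} {h} else 0)"
proof -
  have eq: "g \<noteq> h \<and> S = {g, h} \<longleftrightarrow> h \<in> S \<and> S - {h} = {g}"
    by blast
  have "coeff (gen g * gen h :: ('g, 'k) grassmann) S =
      (if g \<noteq> h \<and> S = {g, h} then shuffle_sign (S - {h}) {h} else 0)"
    unfolding coeff_mult_gen gen.rep_eq eq
    by (cases "h \<in> S"; cases "S - {h} = {g}";
        simp only: if_True if_False simp_thms mult_1_right mult_zero_right)
  moreover have "S - {h} = {g}" if "g \<noteq> h \<and> S = {g, h}"
    using that by blast
  ultimately show ?thesis
    by presburger
qed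

lemma gen_square: "gen g * gen g = (0 :: ('g::{finite,linorder}, 'k::comm_ring_1) grassmann)"
  by (rule grassmann_eqI) (simp add: coeff_gen_mult_gen zero_grassmann.rep_eq)

lemma gen_anticommute:
  fixes g h :: "'g::{finite,linorder}"
  shows "gen g * gen h = - (gen h * gen g :: ('g, 'k::comm_ring_1) grassmann)"
proof (rule grassmann_eqI)
  fix S
  have "{h, g} = {g, h}"
    by (rule insert_commute)
  then show "coeff (gen g * gen h) S = coeff (- (gen h * gen g :: ('g, 'k) grassmann)) S"
    by (simp only: coeff_gen_mult_gen uminus_grassmann.rep_eq shuffle_sign_singletons) auto
qed

lemma rderiv_one: "rderiv g 1 = 0"
  by transfer auto

lemma rderiv_add: "rderiv g (f + f') = rderiv g f + rderiv g f'"
  by transfer (auto simp: algebra_simps)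

lemma rderiv_gscale: "rderiv g (c *\<^sub>G f) = c *\<^sub>G rderiv g f"
  by transfer (auto simp: algebra_simps)

lemma rderiv_mult_gen:
  fixes f :: "('g::{finite,linorder}, 'k::comm_ring_1) grassmann"
  shows "rderiv g (f * gen h) = (if g = h then f else 0) - rderiv g f * gen h"
proof (rule grassmann_eqI)
  fix S
  show "coeff (rderiv g (f * gen h)) S = coeff ((if g = h then f else 0) - rderiv g f * gen h) S"
  proof (cases "g = h")
    case True
    then show ?thesis
      by (auto simp: rderiv.rep_eq coeff_mult_gen minus_grassmann.rep_eq insert_absorb)
  next
    case gh: False
    show ?thesis
    proof (cases "g \<notin> S \<and> h \<in> S")
      case True
      define T where "T = S - {h}"
      have S: "S = T \<union> {h}" and T: "h \<notin> T" "g \<notin> T"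
        using True by (auto simp: T_def)
      have 1: "insert g S - {h} = insert g T" and 2: "S - {h} = T"
        using T gh by (auto simp: S)
      have s1: "shuffle_sign S {g} = (shuffle_sign T {g} * shuffle_sign {h} {g} :: 'k)"
        unfolding S by (rule shuffle_sign_Un_left) (use T in auto)
      have s2: "shuffle_sign (insert g T) {h} = (shuffle_sign T {h} * shuffle_sign {g} {h} :: 'k)"
        using shuffle_sign_Un_left [of T "{g}" "{h}"] T by simp
      have s3: "shuffle_sign {h} {g} * shuffle_sign {g} {h} = (- 1 :: 'k)"
        using gh by (auto simp: shuffle_sign_singletons)
      have "coeff (rderiv g (f * gen h)) S =
          (shuffle_sign {h} {g} * shuffle_sign {g} {h}) *
          (shuffle_sign T {h} * (shuffle_sign T {g} * coeff f (insert g T)))"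
        using True gh by (simp add: rderiv.rep_eq coeff_mult_gen 1 s1 s2 ac_simps)
      also have "\<dots> = coeff ((if g = h then f else 0) - rderiv g f * gen h) S"
        using True gh T
        by (simp only: s3)
          (simp add: rderiv.rep_eq coeff_mult_gen minus_grassmann.rep_eq uminus_grassmann.rep_eq
            zero_grassmann.rep_eq 2)
      finally show ?thesis .
    next
      case False
      then show ?thesis
        using gh
        by (auto simp: rderiv.rep_eq coeff_mult_gen minus_grassmann.rep_eq
            uminus_grassmann.rep_eq zero_grassmann.rep_eq)
    qed
  qed
qed

text \<open>The topology of coefficientwise convergence.\<close>

instantiation grassmann :: (type, topological_space) topological_space
begin

definition open_grassmann :: "('a, 'b) grassmann set \<Rightarrow> bool" where
  "open_grassmann U \<longleftrightarrow> open (coeff ` U)"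

instance
proof
  show "open (UNIV :: ('a, 'b) grassmann set)"
    by (simp add: open_grassmann_def type_definition.Rep_range [OF type_definition_grassmann])
  have inj: "inj (coeff :: ('a, 'b) grassmann \<Rightarrow> _)"
    by (simp add: coeff_inject inj_on_def)
  show "open (S \<inter> T)" if "open S" "open T" for S T :: "('a, 'b) grassmann set"
    using that by (simp add: open_grassmann_def image_Int [OF inj] open_Int)
  show "open (\<Union>K)" if "\<forall>S\<in>K. open S" for K :: "('a, 'b) grassmann set set"
    using that by (simp add: open_grassmann_def image_Union open_UN)
qed

end

lemma open_coeff_vimage:
  fixes V :: "'k::topological_space set"
  assumes "open V"
  shows "open {f :: ('g, 'k) grassmann. coeff f S \<in> V}"
proof -
  have "coeff ` {f :: ('g, 'k) grassmann. coeff f S \<in> V} = (\<lambda>F. F S) -` V"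
  proof (intro equalityI subsetI)
    fix F assume "F \<in> coeff ` {f :: ('g, 'k) grassmann. coeff f S \<in> V}"
    then show "F \<in> (\<lambda>F. F S) -` V"
      by (elim imageE) simp
  next
    fix F :: "'g set \<Rightarrow> 'k"
    assume F: "F \<in> (\<lambda>F. F S) -` V"
    have *: "coeff (Grassmann F) = F"
      by (rule Grassmann_inverse) (rule UNIV_I)
    show "F \<in> coeff ` {f. coeff f S \<in> V}"
      by (rule image_eqI [of _ _ "Grassmann F"]) (use F in \<open>simp_all add: *\<close>)
  qed
  moreover have "open ((\<lambda>F :: 'g set \<Rightarrow> 'k. F S) -` V)"
    by (rule open_vimage [OF assms continuous_on_product_coordinates])
  ultimately show ?thesis
    by (simp only: open_grassmann_def)
qed

instance grassmann :: (type, t2_space) t2_space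
proof
  fix f g :: "('a, 'b) grassmann"
  assume "f \<noteq> g"
  then have "coeff f \<noteq> coeff g"
    by (simp add: coeff_inject)
  then obtain S where "coeff f S \<noteq> coeff g S"
    by (auto simp: fun_eq_iff)
  from hausdorff [OF this] obtain U V
    where UV: "open U" "open V" "coeff f S \<in> U" "coeff g S \<in> V" "U \<inter> V = {}"
    by (elim exE conjE)
  let ?U = "{f :: ('a, 'b) grassmann. coeff f S \<in> U}"
  let ?V = "{f :: ('a, 'b) grassmann. coeff f S \<in> V}"
  have "open ?U" "open ?V"
    by (rule open_coeff_vimage [OF UV(1)], rule open_coeff_vimage [OF UV(2)])
  moreover have "f \<in> ?U" "g \<in> ?V"
    using UV(3,4) by simp_all
  moreover have "?U \<inter> ?V = {}"
    using UV(5) by blast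
  ultimately show "\<exists>U V. open U \<and> open V \<and> f \<in> U \<and> g \<in> V \<and> U \<inter> V = {}"
    by (intro exI conjI)
qed

section \<open>Two Grassmann fields on the plane and their first derivatives\<close>

datatype coord = X | Y

datatype species = F1 | F2

text \<open>\<open>Psi a\<close> is the field \<open>\<psi>\<^sub>a\<close> and \<open>DPsi \<mu> a\<close> its derivative \<open>\<partial>\<^sub>\<mu>\<psi>\<^sub>a\<close>.\<close>

datatype jet = Psi species | DPsi coord species

lemma UNIV_coord: "UNIV = {X, Y}"
  using coord.exhaust by auto

lemma UNIV_species: "UNIV = {F1, F2}"
  using species.exhaust by auto

instance coord :: finite
  by standard (simp add: UNIV_coord)

instance species :: finite
  by standard (simp add: UNIV_species)

fun jet_rank :: "jet \<Rightarrow> nat" where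
  "jet_rank (Psi F1) = 0"
| "jet_rank (Psi F2) = 1"
| "jet_rank (DPsi X F1) = 2"
| "jet_rank (DPsi X F2) = 3"
| "jet_rank (DPsi Y F1) = 4"
| "jet_rank (DPsi Y F2) = 5"

lemma jet_rank_inject: "jet_rank g = jet_rank h \<Longrightarrow> g = h"
  by (cases g rule: jet_rank.cases; cases h rule: jet_rank.cases) simp_all

lemma UNIV_jet: "UNIV = {Psi F1, Psi F2, DPsi X F1, DPsi X F2, DPsi Y F1, DPsi Y F2}"
proof -
  have "g \<in> {Psi F1, Psi F2, DPsi X F1, DPsi X F2, DPsi Y F1, DPsi Y F2}" for g
    by (cases g rule: jet_rank.cases) simp_all
  then show ?thesis
    by blast
qed

instantiation jet :: "{finite, linorder}"
begin

definition less_eq_jet :: "jet \<Rightarrow> jet \<Rightarrow> bool" where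
  "less_eq_jet g h \<longleftrightarrow> jet_rank g \<le> jet_rank h"

definition less_jet :: "jet \<Rightarrow> jet \<Rightarrow> bool" where
  "less_jet g h \<longleftrightarrow> jet_rank g < jet_rank h"

instance
  by standard (auto simp: less_eq_jet_def less_jet_def UNIV_jet intro: jet_rank_inject)

end

type_synonym 'k lagrangian = "(jet, 'k) grassmann"

abbreviation \<psi> :: "species \<Rightarrow> 'k::comm_ring_1 lagrangian" where
  "\<psi> a \<equiv> gen (Psi a)"

abbreviation D\<psi> :: "coord \<Rightarrow> species \<Rightarrow> 'k::comm_ring_1 lagrangian" where
  "D\<psi> \<mu> a \<equiv> gen (DPsi \<mu> a)"

definition seed_lagrangian :: "'k::field_char_0 lagrangian" where
  "seed_lagrangian =
     \<psi> F1 * D\<psi> X F1 - (1/2) *\<^sub>G (\<psi> F2 * D\<psi> Y F1) - (1/2) *\<^sub>G (\<psi> F1 * D\<psi> Y F2)"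

text \<open>\<open>stress \<alpha> \<mu> L\<close> is \<open>T\<^sup>\<alpha>\<^sub>\<mu>\<close> and \<open>current \<beta> L\<close> is \<open>J\<^sup>\<beta>\<close>, computed from the Lagrangian \<open>L\<close>.\<close>

definition stress :: "coord \<Rightarrow> coord \<Rightarrow> 'k::field_char_0 lagrangian \<Rightarrow> 'k lagrangian" where
  "stress \<alpha> \<mu> L =
     (\<Sum>a\<in>UNIV. rderiv (DPsi \<alpha> a) L * D\<psi> \<mu> a) - (if \<alpha> = \<mu> then L else 0)"

definition current :: "coord \<Rightarrow> 'k::field_char_0 lagrangian \<Rightarrow> 'k lagrangian" where
  "current \<beta> L =
     (1/2) *\<^sub>G (rderiv (DPsi \<beta> F2) L * \<psi> F2) - (1/2) *\<^sub>G (rderiv (DPsi \<beta> F1) L * \<psi> F1)"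

lemma gscale_simps [simp]:
  "c *\<^sub>G 0 = 0" "0 *\<^sub>G f = 0" "1 *\<^sub>G f = f" "c *\<^sub>G (- f) = (- c) *\<^sub>G f"
  "- (c *\<^sub>G f) = (- c) *\<^sub>G f" "c *\<^sub>G d *\<^sub>G f = (c * d) *\<^sub>G f"
  by (transfer; simp add: ac_simps)+

lemma gscale_mult_left: "(c *\<^sub>G f) * g = c *\<^sub>G (f * g)"
  for f g :: "('g::{finite,linorder}, 'k::comm_ring_1) grassmann"
  by (rule grassmann_eqI)
    (simp add: gscale.rep_eq times_grassmann.rep_eq sum_distrib_left ac_simps)

lemma rderiv_diff: "rderiv g (f - f') = rderiv g f - rderiv g f'"
  by transfer (auto simp: algebra_simps)

lemma rderiv_gen: "rderiv g (gen h) = (if g = h then 1 else 0)"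
  using rderiv_mult_gen [of g 1 h] by (simp add: rderiv_one)

text \<open>The seed current, fixing the signs of the conventions above.\<close>

lemma current_seed_X: "current X seed_lagrangian = (0 :: 'k::field_char_0 lagrangian)"
  by (simp add: current_def seed_lagrangian_def rderiv_diff rderiv_gscale rderiv_mult_gen
      rderiv_gen gen_square)

lemma current_seed_Y:
  "current Y seed_lagrangian = (- (1/2)) *\<^sub>G (\<psi> F1 * \<psi> F2 :: 'k::field_char_0 lagrangian)"
proof -
  have "current Y seed_lagrangian =
      (- (1/4)) *\<^sub>G (\<psi> F1 * \<psi> F2) + (1/4) *\<^sub>G (\<psi> F2 * \<psi> F1 :: 'k lagrangian)"
    by (simp add: current_def seed_lagrangian_def rderiv_diff rderiv_gscale rderiv_mult_gen
        rderiv_gen gscale_mult_left)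
  also have "\<dots> = (- (1/2)) *\<^sub>G (\<psi> F1 * \<psi> F2)"
    unfolding gen_anticommute [of "Psi F2" "Psi F1"]
    by (rule grassmann_eqI)
      (simp add: gscale.rep_eq uminus_grassmann.rep_eq plus_grassmann.rep_eq)
  finally show ?thesis .
qed

text \<open>
  The family of coefficients is indexed by words: \<open>L [\<mu>\<^sub>1, \<dots>, \<mu>\<^sub>n]\<close> is the coefficient with
  indices \<open>\<mu>\<^sub>1 \<dots> \<mu>\<^sub>n\<close>, and \<open>take i\<close>, \<open>drop i\<close> split the indices after position \<open>i\<close>.
\<close>

definition JT_recursion :: "(coord list \<Rightarrow> 'k::field_char_0 lagrangian) \<Rightarrow> bool" where
  "JT_recursion L \<longleftrightarrow> (\<forall>\<mu>s \<nu>. L (\<mu>s @ [\<nu>]) =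
     (\<Sum>i = 0..length \<mu>s. of_nat (length \<mu>s choose i) *
        (current Y (L (drop i \<mu>s)) * stress X \<nu> (L (take i \<mu>s))
         - current X (L (drop i \<mu>s)) * stress Y \<nu> (L (take i \<mu>s)))))"

definition deformation_term ::
    "(coord list \<Rightarrow> 'k::field_char_0 lagrangian) \<Rightarrow> (coord \<Rightarrow> 'k) \<Rightarrow> nat \<Rightarrow> 'k lagrangian" where
  "deformation_term L lam n =
     (1 / fact n) *\<^sub>G (\<Sum>\<mu>s | length \<mu>s = n. prod_list (map lam \<mu>s) *\<^sub>G L \<mu>s)"

definition deformed_lagrangian ::
    "(coord list \<Rightarrow> 'k::real_normed_field lagrangian) \<Rightarrow> (coord \<Rightarrow> 'k) \<Rightarrow> 'k lagrangian" where
  "deformed_lagrangian L lam = (\<Sum>n. deformation_term L lam n)"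

end

(* The seed current J^y is a multiple of psi_1 psi_2, while every monomial of every component of the
   seed stress tensor T^x contains an undifferentiated psi_1 or psi_2; hence J^y T^x = 0, and since
   J^x = 0 the first-order coefficients vanish. At higher orders each term of the recursion has a
   factor computed from a vanishing coefficient of positive order. *)

theory Submission
  imports Defs
begin

lemma gscale_mult_right: "f * (c *\<^sub>G g) = c *\<^sub>G (f * g)"
  for f g :: "('g::{finite,linorder}, 'k::comm_ring_1) grassmann"
  by (rule grassmann_eqI)
    (simp add: gscale.rep_eq times_grassmann.rep_eq sum_distrib_left ac_simps)

lemma rderiv_zero [simp]: "rderiv g 0 = 0"
  by transfer auto

lemma stress_zero [simp]: "stress \<alpha> \<mu> 0 = 0"
  by (simp add: stress_def)

lemma current_zero [simp]: "current \<beta> 0 = 0"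
  by (simp add: current_def)

text \<open>There are only two species, so a third undifferentiated field repeats one of the first
  two; anticommuting makes the equal factors adjacent, and their square vanishes.\<close>

lemma psi_cubic_zero: "\<psi> F1 * \<psi> F2 * (\<psi> a * g) = (0 :: 'k::comm_ring_1 lagrangian)"
proof (cases a)
  case F1
  have "\<psi> F1 * \<psi> F2 * (\<psi> F1 * g) = \<psi> F1 * (\<psi> F2 * \<psi> F1) * g"
    by (simp add: mult.assoc)
  also have "\<dots> = - (\<psi> F1 * \<psi> F1 * \<psi> F2 * g)"
    by (subst gen_anticommute) (simp add: mult.assoc)
  finally show ?thesis
    by (simp add: F1 gen_square)
next
  case F2
  have "\<psi> F1 * \<psi> F2 * (\<psi> F2 * g) = \<psi> F1 * (\<psi> F2 * \<psi> F2) * g"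
    by (simp add: mult.assoc)
  then show ?thesis
    by (simp add: F2 gen_square)
qed

text \<open>Only the first term of the seed has an x-derivative. It stands on the right, so the
  right derivative leaves \<open>\<psi> F1\<close> without a sign.\<close>

lemma stress_X_seed:
  "stress X \<nu> seed_lagrangian =
    \<psi> F1 * D\<psi> \<nu> F1 - (if \<nu> = X then seed_lagrangian else 0 :: 'k::field_char_0 lagrangian)"
  by (auto simp: stress_def seed_lagrangian_def UNIV_species rderiv_diff rderiv_gscale
      rderiv_mult_gen rderiv_gen)

text \<open>Each monomial of the seed begins with an undifferentiated field, as
  \<open>psi_cubic_zero\<close> requires.\<close>

lemma psi_psi_seed: "\<psi> F1 * \<psi> F2 * seed_lagrangian = (0 :: 'k::field_char_0 lagrangian)"
  by (simp only: seed_lagrangian_def right_diff_distrib gscale_mult_right psi_cubic_zero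
      gscale_simps diff_self)

lemma current_stress_seed:
  "current Y seed_lagrangian * stress X \<nu> seed_lagrangian = (0 :: 'k::field_char_0 lagrangian)"
  by (simp add: current_seed_Y stress_X_seed gscale_mult_left right_diff_distrib psi_cubic_zero
      psi_psi_seed)

lemma JT_recursion_vanishing:
  fixes L :: "coord list \<Rightarrow> 'k::field_char_0 lagrangian"
  assumes seed: "L [] = seed_lagrangian" and recursion: "JT_recursion L"
  shows "\<mu>s \<noteq> [] \<Longrightarrow> L \<mu>s = 0"
proof (induction \<mu>s rule: length_induct)
  case (1 \<mu>s)
  then obtain \<kappa>s \<nu> where \<mu>s: "\<mu>s = \<kappa>s @ [\<nu>]"
    by (metis rev_exhaust)
  \<comment> \<open>The bound is not strict: \<open>take\<close> and \<open>drop\<close> may return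
    all of \<open>\<kappa>s\<close>, which is still one letter shorter than
    \<open>\<mu>s\<close>.\<close>
  have IH: "L \<kappa> = 0" if "\<kappa> \<noteq> []" "length \<kappa> \<le> length \<kappa>s" for \<kappa>
    using 1 that by (simp add: \<mu>s)
  have "current Y (L (drop i \<kappa>s)) * stress X \<nu> (L (take i \<kappa>s))
      - current X (L (drop i \<kappa>s)) * stress Y \<nu> (L (take i \<kappa>s)) = 0" for i
  proof -
    \<comment> \<open>First order is the seed computation; otherwise a nonempty suffix kills both
      currents, or a nonempty prefix both stress factors.\<close>
    consider "\<kappa>s = []" | "drop i \<kappa>s \<noteq> []" | "take i \<kappa>s \<noteq> []"
      by (metis append_Nil append_take_drop_id)
    then show ?thesis
      by cases (simp_all add: seed current_seed_X current_stress_seed IH)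
  qed
  then show ?case
    using recursion by (simp add: JT_recursion_def \<mu>s)
qed

theorem mainTheorem7:
  fixes L :: "coord list \<Rightarrow> 'k::real_normed_field lagrangian"
  assumes seed: "L [] = seed_lagrangian"
    and recursion: "JT_recursion L"
  shows "(\<forall>\<mu>s. length \<mu>s \<ge> 1 \<longrightarrow> L \<mu>s = 0) \<and>
    (\<forall>lam. summable (deformation_term L lam) \<and> deformed_lagrangian L lam = seed_lagrangian)"
proof (intro conjI allI impI)
  have vanish: "L \<mu>s = 0" if "\<mu>s \<noteq> []" for \<mu>s
    using JT_recursion_vanishing [OF seed recursion that] .
  show "L \<mu>s = 0" if "length \<mu>s \<ge> 1" for \<mu>s
    using that by (intro vanish) auto
  fix lam
  have zero: "deformation_term L lam n = 0" if "n \<noteq> 0" for n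
  proof -
    have "(\<Sum>\<mu>s | length \<mu>s = n. prod_list (map lam \<mu>s) *\<^sub>G L \<mu>s) = 0"
      using that by (intro sum.neutral) (auto simp: vanish)
    then show ?thesis
      by (simp add: deformation_term_def)
  qed
  have "deformation_term L lam 0 = seed_lagrangian"
    by (simp add: deformation_term_def seed)
  then have sums: "deformation_term L lam sums seed_lagrangian"
    using sums_finite [of "{0}" "deformation_term L lam"] zero by simp
  show "summable (deformation_term L lam)"
    using sums by (rule sums_summable)
  \<comment> \<open>Limits are unique because the coefficientwise topology is Hausdorff.\<close>
  show "deformed_lagrangian L lam = seed_lagrangian"
    unfolding deformed_lagrangian_def using sums by (rule sums_unique [symmetric])
qed

end
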